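(* Let $(\mathcal{X},d)$ be a metric space, $1<p<\infty$ and $0<\alpha<1$. For $\gamma:[0,1]\to\mathcal{X}$ the following are equivalent: 1. $\gamma$ is a constant-speed geodesic. 2. $\gamma$ is continuous and $d(\gamma_0,\gamma_1)^p=\big(1-2^{-(p-\alpha p)}\big)\,|\gamma|_{b^{\alpha,p}}^p$.
   Context: A constant-speed geodesic is a curve $\gamma:[0,1]\to\mathcal{X}$ with $d(\gamma_s,\gamma_t)=|t-s|\,d(\gamma_0,\gamma_1)$ for all $s,t\in[0,1]$. For $\gamma:[0,1]\to\mathcal{X}$, $$|\gamma|_{b^{\alpha,p}}=\Big(\sum_{m=0}^\infty 2^{m(\alpha p-1)}\sum_{k=0}^{2^m-1}d\big(\gamma_{k/2^m},\gamma_{(k+1)/2^m}\big)^p\Big)^{1/p}\in[0,+\infty].$$ *)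

theory Defs
  imports "HOL-Analysis.Analysis"
begin

text \<open>Curves are functions on the whole real line of which only the values on \<open>{0..1}\<close> matter.\<close>

definition constant_speed_geodesic :: "(real \<Rightarrow> 'a::metric_space) \<Rightarrow> bool" where
  "constant_speed_geodesic \<gamma> \<longleftrightarrow>
    (\<forall>s\<in>{0..1}. \<forall>t\<in>{0..1}. dist (\<gamma> s) (\<gamma> t) = \<bar>t - s\<bar> * dist (\<gamma> 0) (\<gamma> 1))"

text \<open>Real powers on \<open>[0,\<infinity>]\<close>, meant for exponents \<open>r > 0\<close> only: \<open>\<infinity>\<close> is sent to \<open>\<infinity>\<close>
  (and \<open>0\<close> to \<open>0\<close>) whatever the exponent.\<close>

definition ennreal_powr :: "ennreal \<Rightarrow> real \<Rightarrow> ennreal" where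
  "ennreal_powr x r = (if x = \<infinity> then \<infinity> else ennreal (enn2real x powr r))"

definition besov_seminorm :: "real \<Rightarrow> real \<Rightarrow> (real \<Rightarrow> 'a::metric_space) \<Rightarrow> ennreal" where
  "besov_seminorm \<alpha> p \<gamma> =
    ennreal_powr
      (\<Sum>m. ennreal (2 powr (real m * (\<alpha> * p - 1)) *
              (\<Sum>k<2^m. dist (\<gamma> (real k / 2^m)) (\<gamma> (real (k + 1) / 2^m)) powr p)))
      (1 / p)"

end

theory Submission
  imports Defs
begin

text \<open>
  Let \<open>T m = 2\<^bsup>m(p - 1)\<^esup> \<Sum>\<^sub>k d(\<gamma>(k/2\<^sup>m), \<gamma>((k+1)/2\<^sup>m))\<^sup>p\<close> and \<open>r = 2\<^bsup>-(p - \<alpha>p)\<^esup> < 1\<close>. Then the \<open>p\<close>-th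
  power of the Besov seminorm is \<open>\<Sum>\<^sub>m r\<^sup>m T m\<close>, and \<open>T 0 = d(\<gamma> 0, \<gamma> 1)\<^sup>p\<close>. The triangle inequality
  and the convexity of \<open>x \<mapsto> x\<^sup>p\<close> show that \<open>T\<close> is nondecreasing, so the identity for the seminorm
  holds iff \<open>T\<close> is constant. By strict convexity this forces every dyadic increment of level \<open>m\<close> to
  have length \<open>d(\<gamma> 0, \<gamma> 1)/2\<^sup>m\<close>. By continuity \<open>\<gamma>\<close> is then \<open>d(\<gamma> 0, \<gamma> 1)\<close>-Lipschitz, and a curve
  whose end points are as far apart as its Lipschitz constant allows is a constant-speed geodesic.
\<close>

section \<open>Real powers: invertibility and strict convexity\<close>

lemma ennreal_powr_inverse:
  assumes "p \<noteq> 0"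
  shows "ennreal_powr (ennreal_powr x (1 / p)) p = x"
  using assms by (cases x) (auto simp: ennreal_powr_def powr_powr)

text \<open>The derivative \<open>p * x powr (p - 1)\<close> is strictly increasing, so by the mean
  value theorem the graph lies strictly above its tangent at \<open>1\<close> on either side;
  \<open>u = 0\<close> is separate because the derivative rule needs positive points.\<close>

lemma powr_greater_tangent:
  fixes u p :: real
  assumes "1 < p" "0 \<le> u" "u \<noteq> 1"
  shows "1 + p * (u - 1) < u powr p"
proof -
  have D: "((\<lambda>x. x powr p) has_real_derivative p * x powr (p - 1)) (at x)" if "0 < x" for x :: real
    using that by (auto intro!: derivative_eq_intros)
  consider "u = 0" | "0 < u" "u < 1" | "1 < u" using assms by linarith
  then show ?thesis
  proof cases
    case 1
    then show ?thesis using assms by simp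
  next
    case 2
    obtain z where z: "u < z" "z < 1" "1 powr p - u powr p = (1 - u) * (p * z powr (p - 1))"
      using MVT2[of u 1 "\<lambda>x. x powr p" "\<lambda>x. p * x powr (p - 1)"] D 2 by force
    have "z powr (p - 1) < 1"
      using powr_less_mono2[of "p - 1" z 1] assms z 2 by simp
    then have "(1 - u) * (p * z powr (p - 1)) < (1 - u) * (p * 1)"
      using 2 assms by (intro mult_strict_left_mono) auto
    then show ?thesis using z by (simp add: algebra_simps)
  next
    case 3
    obtain z where z: "1 < z" "z < u" "u powr p - 1 powr p = (u - 1) * (p * z powr (p - 1))"
      using MVT2[of 1 u "\<lambda>x. x powr p" "\<lambda>x. p * x powr (p - 1)"] D 3 by force
    have "1 < z powr (p - 1)"
      using powr_less_mono2[of "p - 1" 1 z] assms z by simp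
    then have "(u - 1) * (p * 1) < (u - 1) * (p * z powr (p - 1))"
      using 3 assms by (intro mult_strict_left_mono) auto
    then show ?thesis using z by (simp add: algebra_simps)
  qed
qed

text \<open>Scaling by the midpoint \<open>c\<close> moves the tangency point to \<open>1\<close>.
  In the sum of the tangent bounds at \<open>a / c\<close> and \<open>b / c\<close> the linear terms
  cancel.\<close>

lemma powr_sum_less:
  fixes a b p :: real
  assumes "1 < p" "0 \<le> a" "0 \<le> b" "a \<noteq> b"
  shows "(a + b) powr p < 2 powr (p - 1) * (a powr p + b powr p)"
proof -
  define c where "c = (a + b) / 2"
  \<comment> \<open>Two distinct nonnegative numbers cannot both vanish.\<close>
  have c: "0 < c" using assms by (auto simp: c_def)
  have "1 + p * (a / c - 1) < (a / c) powr p"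
    by (rule powr_greater_tangent) (use assms c in \<open>auto simp: c_def field_simps\<close>)
  moreover have "1 + p * (b / c - 1) < (b / c) powr p"
    by (rule powr_greater_tangent) (use assms c in \<open>auto simp: c_def field_simps\<close>)
  moreover have "p * (a / c - 1) + p * (b / c - 1) = 0"
  proof -
    have "a / c - 1 + (b / c - 1) = 0"
      using c by (simp add: c_def field_simps)
    then show ?thesis by (metis distrib_left mult_zero_right)
  qed
  ultimately have "2 < (a / c) powr p + (b / c) powr p" by linarith
  also have "\<dots> = (a powr p + b powr p) / c powr p"
    using assms c by (simp add: powr_divide add_divide_distrib)
  finally have "2 * c powr p < a powr p + b powr p"
    using c by (simp add: field_simps)
  \<comment> \<open>As \<open>2 powr (p - 1) * 2 = 2 powr p\<close>, this factor turns
    \<open>c\<close> into \<open>2 * c = a + b\<close>.\<close>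
  then have "2 powr (p - 1) * (2 * c powr p) < 2 powr (p - 1) * (a powr p + b powr p)"
    by simp
  also have "2 powr (p - 1) * (2 * c powr p) = (2 * c) powr p"
    using c by (simp add: powr_diff powr_mult)
  also have "2 * c = a + b" by (simp add: c_def)
  finally show ?thesis .
qed

text \<open>Two estimates are chained: monotonicity from \<open>d\<close> to \<open>a + b\<close>,
  then convexity. Equality at the ends makes both sharp; the second then gives \<open>a = b\<close>
  and the first \<open>d = a + b\<close>.\<close>

lemma powr_le_split:
  fixes a b d p :: real
  assumes "1 < p" "0 \<le> a" "0 \<le> b" "0 \<le> d" "d \<le> a + b"
  shows "d powr p \<le> 2 powr (p - 1) * (a powr p + b powr p)"
    and "d powr p = 2 powr (p - 1) * (a powr p + b powr p) \<Longrightarrow> a = d / 2 \<and> b = d / 2"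
proof -
  have le: "d powr p \<le> (a + b) powr p"
    using assms by (intro powr_mono2) auto
  have eq: "(a + b) powr p = 2 powr (p - 1) * (a powr p + b powr p)" if "a = b"
  proof -
    have "(2 * b) powr p = 2 powr (p - 1) * (2 * b powr p)"
      using assms by (simp add: powr_diff powr_mult)
    then show ?thesis using that by simp
  qed
  show "d powr p \<le> 2 powr (p - 1) * (a powr p + b powr p)"
    using le eq powr_sum_less[OF assms(1-3)] by (cases "a = b") auto
  assume *: "d powr p = 2 powr (p - 1) * (a powr p + b powr p)"
  then have ab: "a = b"
    using le powr_sum_less[OF assms(1-3)] by fastforce
  have "\<not> d < a + b"
  proof
    assume "d < a + b"
    then have "d powr p < (a + b) powr p"
      using assms by (intro powr_less_mono2) auto
    then show False using * eq[OF ab] by simp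
  qed
  then have "d = a + b" using assms(5) by linarith
  then show "a = d / 2 \<and> b = d / 2" using ab by simp
qed

section \<open>Dyadic increments and monotonicity of their energies\<close>

definition dyadic_dist :: "(real \<Rightarrow> 'a::metric_space) \<Rightarrow> nat \<Rightarrow> nat \<Rightarrow> real" where
  "dyadic_dist \<gamma> m k = dist (\<gamma> (real k / 2^m)) (\<gamma> (real (k + 1) / 2^m))"

text \<open>The \<open>p\<close>-energy of a curve discretised at scale \<open>2^(-m)\<close>: each
  cell contributes its length times the \<open>p\<close>-th power of its average speed, whence the
  exponent \<open>m * (p - 1)\<close>.\<close>

definition dyadic_energy :: "real \<Rightarrow> (real \<Rightarrow> 'a::metric_space) \<Rightarrow> nat \<Rightarrow> real" where
  "dyadic_energy p \<gamma> m = 2 powr (real m * (p - 1)) * (\<Sum>k<2^m. dyadic_dist \<gamma> m k powr p)"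

lemma dyadic_dist_nonneg [simp]: "0 \<le> dyadic_dist \<gamma> m k"
  by (simp add: dyadic_dist_def)

lemma dyadic_energy_nonneg: "0 \<le> dyadic_energy p \<gamma> m"
  by (simp add: dyadic_energy_def sum_nonneg)

lemma dyadic_energy_0: "dyadic_energy p \<gamma> 0 = dist (\<gamma> 0) (\<gamma> 1) powr p"
  by (simp add: dyadic_energy_def dyadic_dist_def)

lemma dyadic_dist_split:
  "dyadic_dist \<gamma> m k \<le> dyadic_dist \<gamma> (Suc m) (2 * k) + dyadic_dist \<gamma> (Suc m) (2 * k + 1)"
proof -
  have "real (2 * k) / 2 ^ Suc m = real k / 2 ^ m"
    "real (2 * k + 1 + 1) / 2 ^ Suc m = real (k + 1) / 2 ^ m"
    by (simp_all add: field_simps)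
  then show ?thesis
    unfolding dyadic_dist_def by (metis dist_triangle)
qed

text \<open>Grouping the two children of each level-\<open>m\<close> cell makes consecutive energies
  comparable term by term.\<close>

lemma dyadic_energy_Suc:
  "dyadic_energy p \<gamma> (Suc m) = 2 powr (real m * (p - 1)) *
    (\<Sum>k<2^m. 2 powr (p - 1) * (dyadic_dist \<gamma> (Suc m) (2 * k) powr p
                              + dyadic_dist \<gamma> (Suc m) (2 * k + 1) powr p))"
proof -
  have pairs: "sum f {..<2 * n} = (\<Sum>k<n. f (2 * k) + f (2 * k + 1))" for f :: "nat \<Rightarrow> real" and n
    by (induction n) auto
  have "2 powr (real (Suc m) * (p - 1)) = 2 powr (real m * (p - 1)) * 2 powr (p - 1)"
    by (simp add: powr_add[symmetric] algebra_simps)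
  then show ?thesis
    unfolding dyadic_energy_def power_Suc pairs by (simp add: sum_distrib_left mult.assoc)
qed

lemma dyadic_dist_powr_split:
  assumes "1 < p"
  shows "dyadic_dist \<gamma> m k powr p \<le> 2 powr (p - 1) *
      (dyadic_dist \<gamma> (Suc m) (2 * k) powr p + dyadic_dist \<gamma> (Suc m) (2 * k + 1) powr p)"
  by (rule powr_le_split(1)) (use assms dyadic_dist_split in auto)

lemma dyadic_energy_le_Suc:
  assumes "1 < p"
  shows "dyadic_energy p \<gamma> m \<le> dyadic_energy p \<gamma> (Suc m)"
  \<comment> \<open>The order matters: level \<open>Suc m\<close> has to take its paired form before
    the definition is expanded.\<close>
  unfolding dyadic_energy_Suc unfolding dyadic_energy_def
  by (intro mult_left_mono sum_mono dyadic_dist_powr_split assms) auto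

lemma dyadic_energy_0_le:
  assumes "1 < p"
  shows "dyadic_energy p \<gamma> 0 \<le> dyadic_energy p \<gamma> m"
  using lift_Suc_mono_le[of "dyadic_energy p \<gamma>" 0 m] dyadic_energy_le_Suc[OF assms] by blast

text \<open>Equal sums of termwise ordered families have equal terms, which puts every cell of level
  \<open>m\<close> in the equality case of \<open>powr_le_split\<close>.\<close>

lemma dyadic_dist_halves:
  assumes "1 < p" "dyadic_energy p \<gamma> m = dyadic_energy p \<gamma> (Suc m)" "k < 2 ^ m"
  shows "dyadic_dist \<gamma> (Suc m) (2 * k) = dyadic_dist \<gamma> m k / 2"
    and "dyadic_dist \<gamma> (Suc m) (2 * k + 1) = dyadic_dist \<gamma> m k / 2"
proof -
  let ?g = "\<lambda>k. 2 powr (p - 1) *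
      (dyadic_dist \<gamma> (Suc m) (2 * k) powr p + dyadic_dist \<gamma> (Suc m) (2 * k + 1) powr p)"
  have "(\<Sum>k<2^m. dyadic_dist \<gamma> m k powr p) = (\<Sum>k<2^m. ?g k)"
    using assms(2) unfolding dyadic_energy_Suc unfolding dyadic_energy_def by simp
  then have "dyadic_dist \<gamma> m k powr p = ?g k"
    using sum_mono_inv[of "\<lambda>k. dyadic_dist \<gamma> m k powr p" "{..<2^m}" ?g k]
      dyadic_dist_powr_split[OF assms(1)] assms(3) by auto
  then have "dyadic_dist \<gamma> (Suc m) (2 * k) = dyadic_dist \<gamma> m k / 2 \<and>
      dyadic_dist \<gamma> (Suc m) (2 * k + 1) = dyadic_dist \<gamma> m k / 2"
    by (intro powr_le_split(2)) (use assms dyadic_dist_split in auto)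
  then show "dyadic_dist \<gamma> (Suc m) (2 * k) = dyadic_dist \<gamma> m k / 2"
    "dyadic_dist \<gamma> (Suc m) (2 * k + 1) = dyadic_dist \<gamma> m k / 2" by auto
qed

lemma dyadic_dist_const:
  assumes "1 < p" "\<And>m. dyadic_energy p \<gamma> m = dyadic_energy p \<gamma> 0" "k < 2 ^ m"
  shows "dyadic_dist \<gamma> m k = dist (\<gamma> 0) (\<gamma> 1) / 2 ^ m"
  using assms(3)
proof (induction m arbitrary: k)
  case 0
  then show ?case by (simp add: dyadic_dist_def)
next
  case (Suc m)
  \<comment> \<open>Cell \<open>k\<close> of level \<open>Suc m\<close> is a half of cell
    \<open>k div 2\<close> of level \<open>m\<close>.\<close>
  have k: "k div 2 < 2 ^ m" using Suc.prems by auto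
  have E: "dyadic_energy p \<gamma> m = dyadic_energy p \<gamma> (Suc m)" using assms(2) by metis
  have "k = 2 * (k div 2) \<or> k = 2 * (k div 2) + 1" by presburger
  then have "dyadic_dist \<gamma> (Suc m) k = dyadic_dist \<gamma> m (k div 2) / 2"
    using dyadic_dist_halves[OF assms(1) E k] by metis
  then show ?case using Suc.IH[OF k] by simp
qed

section \<open>From equal dyadic increments to a geodesic\<close>

lemma dist_le_sum_consecutive:
  assumes "i \<le> j"
  shows "dist (f i) (f j) \<le> (\<Sum>k=i..<j. dist (f k) (f (Suc k)))"
  using assms
proof (induction j rule: dec_induct)
  case base
  then show ?case by simp
next
  case (step n)
  then show ?case using dist_triangle[of "f i" "f (Suc n)" "f n"] by simp
qed

lemma dyadic_lipschitz:
  fixes \<gamma> :: "real \<Rightarrow> 'a::metric_space"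
  assumes "\<And>k. k < 2 ^ m \<Longrightarrow> dyadic_dist \<gamma> m k = L / 2 ^ m" "i \<le> j" "j \<le> 2 ^ m"
  shows "dist (\<gamma> (real i / 2^m)) (\<gamma> (real j / 2^m)) \<le> (real j / 2^m - real i / 2^m) * L"
proof -
  have "dist (\<gamma> (real i / 2^m)) (\<gamma> (real j / 2^m)) \<le> (\<Sum>k=i..<j. dyadic_dist \<gamma> m k)"
    using dist_le_sum_consecutive[OF assms(2), of "\<lambda>k. \<gamma> (real k / 2^m)"]
    by (simp add: dyadic_dist_def)
  also have "\<dots> = (\<Sum>k=i..<j. L / 2^m)"
    using assms by (intro sum.cong) auto
  also have "\<dots> = (real j / 2^m - real i / 2^m) * L"
    using assms(2) by (simp add: of_nat_diff field_simps)
  finally show ?thesis .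
qed

lemma dyadic_floor_tendsto:
  fixes t :: real
  assumes "0 \<le> t"
  shows "(\<lambda>m. real (nat \<lfloor>t * 2^m\<rfloor>) / 2^m) \<longlonglongrightarrow> t"
proof (rule tendsto_sandwich)
  have lower: "t - (1/2)^m \<le> real (nat \<lfloor>t * 2^m\<rfloor>) / 2^m" for m
  proof -
    \<comment> \<open>Rounding down loses at most \<open>1\<close> before the division by
      \<open>2^m\<close>.\<close>
    have "t - (1/2)^m = (t * 2^m - 1) / 2^m" by (simp add: field_simps)
    also have "\<dots> \<le> real (nat \<lfloor>t * 2^m\<rfloor>) / 2^m"
      by (intro divide_right_mono) (linarith, simp)
    finally show ?thesis .
  qed
  have upper: "real (nat \<lfloor>t * 2^m\<rfloor>) / 2^m \<le> t" for m
    using assms by (simp add: field_simps)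
  show "\<forall>\<^sub>F m in sequentially. t - (1/2)^m \<le> real (nat \<lfloor>t * 2^m\<rfloor>) / 2^m"
    "\<forall>\<^sub>F m in sequentially. real (nat \<lfloor>t * 2^m\<rfloor>) / 2^m \<le> t"
    using lower upper by auto
  have "(\<lambda>m. t - (1/2)^m) \<longlonglongrightarrow> t - 0"
    by (intro tendsto_intros LIMSEQ_power_zero) auto
  then show "(\<lambda>m. t - (1/2)^m) \<longlonglongrightarrow> t" by simp
qed simp

text \<open>Both times are approximated from below by dyadic points of level \<open>m\<close>, and
  continuity carries the dyadic estimate to the limit.\<close>

lemma dyadic_const_imp_lipschitz:
  fixes \<gamma> :: "real \<Rightarrow> 'a::metric_space"
  assumes cont: "continuous_on {0..1} \<gamma>"
    and const: "\<And>m k. k < 2 ^ m \<Longrightarrow> dyadic_dist \<gamma> m k = L / 2 ^ m"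
    and st: "0 \<le> s" "s \<le> t" "t \<le> 1"
  shows "dist (\<gamma> s) (\<gamma> t) \<le> (t - s) * L"
proof -
  let ?q = "\<lambda>t m. nat \<lfloor>t * 2^m\<rfloor>"
  let ?d = "\<lambda>t m. real (?q t m) / 2^m"
  have lim: "?d u \<longlonglongrightarrow> u" "(\<lambda>m. \<gamma> (?d u m)) \<longlonglongrightarrow> \<gamma> u" if "0 \<le> u" "u \<le> 1" for u
  proof -
    show "?d u \<longlonglongrightarrow> u" by (rule dyadic_floor_tendsto) fact
    \<comment> \<open>Continuity is given on \<open>{0..1}\<close> only, so the approximants must
      stay inside.\<close>
    have "?d u m \<in> {0..1}" for m
    proof -
      have "real (?q u m) \<le> u * 2^m" using that by simp
      also have "\<dots> \<le> 1 * 2^m" using that by (intro mult_right_mono) auto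
      finally show ?thesis by simp
    qed
    then show "(\<lambda>m. \<gamma> (?d u m)) \<longlonglongrightarrow> \<gamma> u"
      using continuous_on_tendsto_compose[OF cont \<open>?d u \<longlonglongrightarrow> u\<close>] that by auto
  qed
  have "dist (\<gamma> (?d s m)) (\<gamma> (?d t m)) \<le> (?d t m - ?d s m) * L" for m
  proof (rule dyadic_lipschitz[OF const])
    show "?q s m \<le> ?q t m" using st by (intro nat_mono floor_mono mult_right_mono) auto
    have "t * 2^m \<le> 1 * 2^m" using st by (intro mult_right_mono) auto
    \<comment> \<open>At \<open>t = 1\<close> the index is exactly \<open>2^m\<close>, so
      \<open>floor_le_iff\<close> is applied with the strict bound \<open>2^m + 1\<close>.\<close>
    then have "t * 2^m < 2^m + 1" by linarith
    then have "\<lfloor>t * 2^m\<rfloor> \<le> 2 ^ m" by (simp add: floor_le_iff)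
    then show "?q t m \<le> 2 ^ m" by (simp add: nat_le_iff)
  qed
  moreover have "(\<lambda>m. dist (\<gamma> (?d s m)) (\<gamma> (?d t m))) \<longlonglongrightarrow> dist (\<gamma> s) (\<gamma> t)"
    using st by (intro tendsto_dist lim) auto
  moreover have "(\<lambda>m. (?d t m - ?d s m) * L) \<longlonglongrightarrow> (t - s) * L"
    using st by (intro tendsto_intros lim) auto
  ultimately show ?thesis by (intro LIMSEQ_le) auto
qed

text \<open>In the triangle inequality through \<open>\<gamma> s\<close> and
  \<open>\<gamma> t\<close>, the outer pieces are at most \<open>s\<close> and \<open>1 - t\<close>
  times the total distance, so the middle piece must make up the remaining share
  \<open>t - s\<close>.\<close>

lemma lipschitz_imp_constant_speed_geodesic:
  fixes \<gamma> :: "real \<Rightarrow> 'a::metric_space"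
  assumes lip: "\<And>s t. \<lbrakk>0 \<le> s; s \<le> t; t \<le> 1\<rbrakk> \<Longrightarrow> dist (\<gamma> s) (\<gamma> t) \<le> (t - s) * dist (\<gamma> 0) (\<gamma> 1)"
  shows "constant_speed_geodesic \<gamma>"
proof -
  have eq: "dist (\<gamma> s) (\<gamma> t) = (t - s) * dist (\<gamma> 0) (\<gamma> 1)" if "0 \<le> s" "s \<le> t" "t \<le> 1" for s t
  proof (rule antisym)
    have "dist (\<gamma> 0) (\<gamma> 1) \<le> dist (\<gamma> 0) (\<gamma> s) + dist (\<gamma> s) (\<gamma> t) + dist (\<gamma> t) (\<gamma> 1)"
      using dist_triangle[of "\<gamma> 0" "\<gamma> 1" "\<gamma> s"] dist_triangle[of "\<gamma> s" "\<gamma> 1" "\<gamma> t"] by linarith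
    also have "\<dots> \<le> (s - 0) * dist (\<gamma> 0) (\<gamma> 1) + dist (\<gamma> s) (\<gamma> t) + (1 - t) * dist (\<gamma> 0) (\<gamma> 1)"
      using that by (intro add_mono lip) auto
    finally show "(t - s) * dist (\<gamma> 0) (\<gamma> 1) \<le> dist (\<gamma> s) (\<gamma> t)"
      by (simp add: algebra_simps)
  qed (use lip that in auto)
  show ?thesis
    unfolding constant_speed_geodesic_def
  proof (intro ballI)
    fix s t :: real assume "s \<in> {0..1}" "t \<in> {0..1}"
    then show "dist (\<gamma> s) (\<gamma> t) = \<bar>t - s\<bar> * dist (\<gamma> 0) (\<gamma> 1)"
      using eq[of s t] eq[of t s] by (cases "s \<le> t") (auto simp: dist_commute)
  qed
qed

section \<open>Continuity and constant energy of geodesics\<close>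

lemma constant_speed_geodesic_continuous:
  assumes "constant_speed_geodesic \<gamma>"
  shows "continuous_on {0..1} \<gamma>"
proof (rule lipschitz_on_continuous_on)
  show "(dist (\<gamma> 0) (\<gamma> 1))-lipschitz_on {0..1} \<gamma>"
  proof (rule lipschitz_onI)
    fix s t :: real assume "s \<in> {0..1}" "t \<in> {0..1}"
    then have "dist (\<gamma> s) (\<gamma> t) = dist t s * dist (\<gamma> 0) (\<gamma> 1)"
      using assms unfolding constant_speed_geodesic_def dist_real_def by blast
    then show "dist (\<gamma> s) (\<gamma> t) \<le> dist (\<gamma> 0) (\<gamma> 1) * dist s t"
      by (simp add: dist_commute)
  qed simp
qed

lemma constant_speed_geodesic_energy:
  assumes "constant_speed_geodesic \<gamma>"
  shows "dyadic_energy p \<gamma> m = dyadic_energy p \<gamma> 0"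
proof -
  let ?L = "dist (\<gamma> 0) (\<gamma> 1)"
  have "dyadic_dist \<gamma> m k = ?L / 2^m" if "k < 2^m" for k
  proof -
    \<comment> \<open>The right end point of the last cell is \<open>1\<close>, still within the
      range of the geodesic identity.\<close>
    have "real (k + 1) \<le> real (2^m)" using that by (simp only: of_nat_le_iff)
    then have "real k / 2^m \<in> {0..1}" "real (k + 1) / 2^m \<in> {0..1}"
      using that by (auto simp: less_imp_le)
    then have "dyadic_dist \<gamma> m k = \<bar>real (k + 1) / 2^m - real k / 2^m\<bar> * ?L"
      using assms unfolding dyadic_dist_def constant_speed_geodesic_def by blast
    then show ?thesis by (simp add: diff_divide_distrib[symmetric])
  qed
  then have "dyadic_energy p \<gamma> m = 2 powr (real m * (p - 1)) * (2^m * (?L / 2^m) powr p)"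
    unfolding dyadic_energy_def by simp
  also have "\<dots> = ?L powr p"
  proof -
    have "2 powr (real m * (p - 1)) * 2^m = (2^m) powr p"
      by (simp add: powr_realpow[symmetric] powr_powr powr_add[symmetric] algebra_simps)
    then have "2 powr (real m * (p - 1)) * (2^m * (?L / 2^m) powr p)
        = (2^m) powr p * (?L / 2^m) powr p"
      by (metis mult.assoc)
    also have "\<dots> = (2^m * (?L / 2^m)) powr p"
      by (rule powr_mult[symmetric])
    finally show ?thesis by simp
  qed
  finally show ?thesis by (simp add: dyadic_energy_0)
qed

section \<open>The seminorm as a geometrically weighted series of energies\<close>

lemma besov_seminorm_powr:
  assumes "p \<noteq> 0"
  shows "ennreal_powr (besov_seminorm \<alpha> p \<gamma>) p =
    (\<Sum>m. ennreal ((2 powr (- (p - \<alpha> * p))) ^ m * dyadic_energy p \<gamma> m))"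
proof -
  \<comment> \<open>The exponent splits as
    \<open>\<alpha> * p - 1 = - (p - \<alpha> * p) + (p - 1)\<close>.\<close>
  have "2 powr (real m * (\<alpha> * p - 1)) =
      (2 powr (- (p - \<alpha> * p))) ^ m * 2 powr (real m * (p - 1))" for m
    by (simp add: powr_realpow[symmetric] powr_powr powr_add[symmetric] algebra_simps)
  then show ?thesis
    unfolding besov_seminorm_def ennreal_powr_inverse[OF assms] dyadic_energy_def dyadic_dist_def
    by (simp add: mult.assoc)
qed

text \<open>Since \<open>1 - r\<close> normalises the weights \<open>r ^ m\<close> to total mass
  \<open>1\<close>, the identity says that a weighted mean of the \<open>T m\<close> equals their
  minimum \<open>T 0\<close>; positive weights leave no room for a larger term.\<close>

lemma weighted_geometric_eq_iff:
  fixes T :: "nat \<Rightarrow> real"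
  assumes r: "0 < r" "r < 1" and T: "0 \<le> T 0" "\<And>m. T 0 \<le> T m"
  shows "ennreal (T 0) = ennreal (1 - r) * (\<Sum>m. ennreal (r ^ m * T m)) \<longleftrightarrow> (\<forall>m. T m = T 0)"
proof
  have nn: "0 \<le> r ^ m * T m" for m
    using r T(1) T(2)[of m] by simp
  have g: "(\<lambda>m. r ^ m * T 0) sums (1 / (1 - r) * T 0)"
    using r by (intro sums_mult2 geometric_sums) auto
  {
    assume *: "ennreal (T 0) = ennreal (1 - r) * (\<Sum>m. ennreal (r ^ m * T m))"
    \<comment> \<open>An infinite series times the positive \<open>1 - r\<close> would be infinite,
      while the left side is finite.\<close>
    have fin: "(\<Sum>m. ennreal (r ^ m * T m)) \<noteq> top"
    proof
      assume "(\<Sum>m. ennreal (r ^ m * T m)) = top"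
      then show False using * r by (simp add: ennreal_mult_top)
    qed
    have sum: "summable (\<lambda>m. r ^ m * T m)"
      using summable_suminf_not_top[OF nn fin] .
    have "ennreal (T 0) = ennreal ((1 - r) * (\<Sum>m. r ^ m * T m))"
      using * r suminf_ennreal2[OF nn sum] by (simp add: ennreal_mult suminf_nonneg[OF sum nn])
    then have "T 0 = (1 - r) * (\<Sum>m. r ^ m * T m)"
      using r T suminf_nonneg[OF sum nn] by simp
    then have "(\<Sum>m. r ^ m * T m) = 1 / (1 - r) * T 0" using r by (simp add: field_simps)
    then have "(\<lambda>m. r ^ m * T m - r ^ m * T 0) sums 0"
      using sums_diff[OF summable_sums[OF sum] g] by simp
    moreover have "0 \<le> r ^ m * T m - r ^ m * T 0" for m
      using r T(2)[of m] by simp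
    ultimately have "\<forall>m. r ^ m * T m - r ^ m * T 0 = 0"
      using sums_summable sums_unique[THEN sym] by (subst suminf_eq_zero_iff[symmetric]) auto
    then show "\<forall>m. T m = T 0" using r by auto
  }
  assume eq: "\<forall>m. T m = T 0"
  have "(\<Sum>m. ennreal (r ^ m * T m)) = (\<Sum>m. ennreal (r ^ m * T 0))"
    using eq by metis
  also have "\<dots> = ennreal (1 / (1 - r) * T 0)"
    by (rule suminf_ennreal_eq[OF _ g]) (use r T(1) in simp)
  finally have "ennreal (1 - r) * (\<Sum>m. ennreal (r ^ m * T m))
      = ennreal ((1 - r) * (1 / (1 - r) * T 0))"
    using ennreal_mult[of "1 - r" "1 / (1 - r) * T 0"] r T(1) by simp
  then show "ennreal (T 0) = ennreal (1 - r) * (\<Sum>m. ennreal (r ^ m * T m))"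
    using r by simp
qed

theorem lemma3p12:
  fixes \<gamma> :: "real \<Rightarrow> 'a::metric_space" and p \<alpha> :: real
  assumes "1 < p" and "0 < \<alpha>" and "\<alpha> < 1"
  shows "constant_speed_geodesic \<gamma> \<longleftrightarrow>
    continuous_on {0..1} \<gamma> \<and>
    ennreal (dist (\<gamma> 0) (\<gamma> 1) powr p) =
      ennreal (1 - 2 powr (- (p - \<alpha> * p))) * ennreal_powr (besov_seminorm \<alpha> p \<gamma>) p"
proof -
  let ?r = "2 powr (- (p - \<alpha> * p))"
  \<comment> \<open>The bound \<open>\<alpha> < 1\<close> makes the exponent of \<open>?r\<close>
    negative, so the weights decay.\<close>
  have "\<alpha> * p < 1 * p" using assms by (intro mult_strict_right_mono) auto
  then have r: "0 < ?r" "?r < 1"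
    using powr_less_cancel_iff[of 2 "- (p - \<alpha> * p)" 0] by auto
  have "ennreal (dist (\<gamma> 0) (\<gamma> 1) powr p) =
      ennreal (1 - ?r) * ennreal_powr (besov_seminorm \<alpha> p \<gamma>) p \<longleftrightarrow>
      (\<forall>m. dyadic_energy p \<gamma> m = dyadic_energy p \<gamma> 0)"
    using weighted_geometric_eq_iff[where T = "dyadic_energy p \<gamma>",
        OF r dyadic_energy_nonneg dyadic_energy_0_le]
      besov_seminorm_powr[of p \<alpha> \<gamma>] assms(1) by (simp add: dyadic_energy_0)
  moreover have "constant_speed_geodesic \<gamma>"
    if "continuous_on {0..1} \<gamma>" "\<forall>m. dyadic_energy p \<gamma> m = dyadic_energy p \<gamma> 0"
  proof (rule lipschitz_imp_constant_speed_geodesic)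
    have "dyadic_dist \<gamma> m k = dist (\<gamma> 0) (\<gamma> 1) / 2 ^ m" if "k < 2 ^ m" for m k
      using dyadic_dist_const[OF assms(1) _ that]
        \<open>\<forall>m. dyadic_energy p \<gamma> m = dyadic_energy p \<gamma> 0\<close> by blast
    then show "dist (\<gamma> s) (\<gamma> t) \<le> (t - s) * dist (\<gamma> 0) (\<gamma> 1)" if "0 \<le> s" "s \<le> t" "t \<le> 1" for s t
      using dyadic_const_imp_lipschitz[OF \<open>continuous_on {0..1} \<gamma>\<close> _ that] by blast
  qed
  ultimately show ?thesis
    using constant_speed_geodesic_continuous constant_speed_geodesic_energy by blast
qed

end
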